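(* All the solutions $(n,m)$ of the diophantine equation $D_n=m!$ in positive integers $n,m$ are $(2,1)$ and $(3,2)$.
   Context: $(D_n)_{n\ge0}$ is the sequence of numbers of derangements: $D_0=1$, $D_n=nD_{n-1}+(-1)^n$ for $n>0$. *)

theory Defs
  imports Main
begin

(* The values are integers because the recurrence has an alternating sign;
   nat subtraction would truncate. *)
primrec derangement_number :: "nat \<Rightarrow> int" where
  "derangement_number 0 = 1"
| "derangement_number (Suc n) = int (Suc n) * derangement_number n + (- 1) ^ Suc n"

end

theory Submission
  imports Defs
begin

text \<open>Write $D_n = (n-1)(D_{n-1} + D_{n-2})$, where the second factor is odd. If $D_n = m!$ with
  $n \ge 2$, then $m! = D_n \ge (n-1)!$ gives $m \ge n-1$, so $(n-1)!$ divides $D_n$. Cancelling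
  $n-1$, the number $(n-2)!$ divides an odd number, which forces $n \le 3$.\<close>

text \<open>The defining recurrence at \<open>Suc n\<close> gives (-1)^(n+2) = (n+1) D_n - D_(n+1);
  substituting this into the one for D_(n+2) removes the sign.\<close>

lemma derangement_number_Suc_Suc:
  "derangement_number (Suc (Suc n)) = int (Suc n) * (derangement_number (Suc n) + derangement_number n)"
  by (simp add: algebra_simps)

text \<open>The sign term is odd, so D_(n+1) is even exactly when n+1 and D_n are both odd. Hence
  consecutive values have opposite parity and an odd sum.\<close>

lemma even_derangement_number_iff: "even (derangement_number n) \<longleftrightarrow> odd n"
  by (induction n) auto

lemma derangement_number_nonneg: "derangement_number n \<ge> 0"
  by (induction n rule: induct_nat_012)
    (simp_all only: derangement_number_Suc_Suc zero_le_mult_iff add_nonneg_nonneg of_nat_0_le_iff, simp_all)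

text \<open>Dropping a nonnegative summand from the two-term recurrence leaves the recurrence of the
  factorial. The induction starts at D_2 = 1 because D_1 = 0 is less than 0!.\<close>

lemma fact_le_derangement_number: "fact (Suc n) \<le> derangement_number (Suc (Suc n))"
proof (induction n)
  case 0
  show ?case by simp
next
  case (Suc n)
  have "fact (Suc (Suc n)) = int (Suc (Suc n)) * fact (Suc n)"
    by (simp only: fact_Suc)
  also have "\<dots> \<le> int (Suc (Suc n)) *
      (derangement_number (Suc (Suc n)) + derangement_number (Suc n))"
    using Suc derangement_number_nonneg[of "Suc n"] by (intro mult_left_mono) linarith+
  finally show ?case
    by (simp only: derangement_number_Suc_Suc)
qed

lemma derangement_number_eq_fact_le_3:
  assumes "m > 0" and "derangement_number n = fact m"
  shows "n \<le> 3"
proof (rule ccontr)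
  assume "\<not> n \<le> 3"
  then obtain k where n: "n = Suc (Suc k)" and "k \<ge> 2"
    by (intro that[of "n - 2"]) auto
  have "(fact (Suc k) :: int) \<le> fact m"
    using fact_le_derangement_number[of k] assms(2) n by simp
  \<comment> \<open>Since 0! = 1!, the factorial is strictly increasing only from 1 on, whence the
    appeal to \<open>m > 0\<close>.\<close>
  then have "Suc k \<le> m"
    using fact_less_mono[of m "Suc k", where 'a = int] \<open>m > 0\<close> by linarith
  then have "(fact (Suc k) :: int) dvd derangement_number n"
    using assms(2) by (simp only: fact_dvd)
  then have "int (Suc k) * fact k dvd
      int (Suc k) * (derangement_number (Suc k) + derangement_number k)"
    by (simp only: n fact_Suc derangement_number_Suc_Suc)
  then have "fact k dvd derangement_number (Suc k) + derangement_number k"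
    by (simp only: dvd_mult_cancel_left) simp
  \<comment> \<open>This is where n > 3 enters: 2! divides \<open>fact k\<close> once
    \<open>k \<ge> 2\<close>.\<close>
  moreover have "even (fact k :: int)"
    using fact_dvd[OF \<open>k \<ge> 2\<close>, where 'a = int] by simp
  ultimately have "even (derangement_number (Suc k) + derangement_number k)"
    by (rule dvd_trans[rotated])
  then show False
    unfolding even_add even_derangement_number_iff by simp
qed

theorem proposition25:
  shows "{(n :: nat, m :: nat). n > 0 \<and> m > 0 \<and> derangement_number n = fact m}
           = {(2, 1), (3, 2)}"
proof -
  have "(n = 2 \<and> m = 1) \<or> (n = 3 \<and> m = 2)"
    if "n > 0" "m > 0" and eq: "derangement_number n = fact m" for n m
  proof -
    have "n \<le> 3"
      using that derangement_number_eq_fact_le_3 by blast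
    then consider "n = 1" | "n = 2" | "n = 3"
      using \<open>n > 0\<close> by linarith
    then show ?thesis
    proof cases
      \<comment> \<open>D_1 = 0, and no factorial vanishes.\<close>
      case 1
      then show ?thesis using eq by simp
    next
      case 2
      then have "\<not> 1 < m"
        using eq fact_less_mono[of 1 m, where 'a = int] by (auto simp: numeral_2_eq_2)
      then show ?thesis using 2 \<open>m > 0\<close> by linarith
    next
      case 3
      then have "(fact m :: int) = 2"
        using eq by (simp add: numeral_3_eq_3)
      then have "m \<noteq> 1" and "\<not> 2 < m"
        using fact_less_mono[of 2 m, where 'a = int] by auto
      then show ?thesis using 3 \<open>m > 0\<close> by linarith
    qed
  qed
  moreover have "derangement_number 2 = fact 1" "derangement_number 3 = fact 2"
    by (simp_all add: numeral_2_eq_2 numeral_3_eq_3)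
  ultimately show ?thesis by auto
qed

end
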